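(* Let $n\ge 0$ and let $Q_n$ be the free quandle on $n$ generators $y_1,\dots,y_n$. Let $t$ be a closed term over the signature $\Sigma(x,y_1,\dots,y_n)$. Then $[t]$ belongs to the logical isotropy group $G_{\mathrm{Quandle}}(Q_n)$ if and only if there are $m\ge 0$, indices $1\le i_1,\dots,i_m\le n$ and signs $\epsilon_1,\dots,\epsilon_m\in\{1,-1\}$ such that $$[t]=\left[x\lhd^{\epsilon_1}y_{i_1}\lhd^{\epsilon_2}\cdots\lhd^{\epsilon_m}y_{i_m}\right]$$ and the corresponding group word $y_{i_1}^{\epsilon_1}\cdots y_{i_m}^{\epsilon_m}$ is reduced.
   Context: A quandle is a set with two binary operations $\lhd,\lhd^{-1}$ satisfying, for all $x,y,z$: $(x\lhd y)\lhd z=(x\lhd z)\lhd(y\lhd z)$; $(x\lhd^{-1}y)\lhd^{-1}z=(x\lhd^{-1}z)\lhd^{-1}(y\lhd^{-1}z)$; $(x\lhd y)\lhd^{-1}y=x$; $(x\lhd^{-1}y)\lhd y=x$; $x\lhd x=x$; $x\lhd^{-1}x=x$. We write $\lhd^{1}=\lhd$, and $a\lhd^{\epsilon_1}b_1\lhd^{\epsilon_2}\cdots\lhd^{\epsilon_m}b_m$ means the left-bracketed expression $(\cdots((a\lhd^{\epsilon_1}b_1)\lhd^{\epsilon_2}b_2)\cdots)\lhd^{\epsilon_m}b_m$ (which is $a$ if $m=0$). For a finite set $X$ of constants, $\Sigma(X)$ is the signature with binary symbols $\lhd,\lhd^{-1}$ and the elements of $X$ as constants. For closed terms $s,t$ over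 $\Sigma(X)$, $s\sim t$ means that $s=t$ is provable from the quandle axioms over $\Sigma(X)$; $[t]$ is the $\sim$-class of $t$. The free quandle on $y_1,\dots,y_n$ is the set $Q_n$ of $\sim$-classes of closed terms over $\Sigma(y_1,\dots,y_n)$. Let $x,x_0,x_1$ be further distinct constants, and let $t[s/x]$ denote the result of replacing every occurrence of $x$ in $t$ by $s$. The logical isotropy group $G_{\mathrm{Quandle}}(Q_n)$ is the set of all classes $[t]$ of closed terms $t$ over $\Sigma(x,y_1,\dots,y_n)$ (modulo provable equality in the theory of quandles) such that: (1) $[t]$ is invertible: there is a closed term $s$ over $\Sigma(x,y_1,\dots,y_n)$ with $t[s/x]\sim x\sim s[t/x]$; and (2) $[t]$ commutes generically with the operations: $t[(x_0\lhd^{\epsilon} x_1)/x]\sim t[x_0/x]\lhd^{\epsilon} t[x_1/x]$ over $\Sigma(x_0,x_1,y_1,\dots,y_n)$ for $\epsilon=1$ and $\epsilon=-1$. It is a group with unit $[x]$ and product $[t]\cdot[s]=[t[s/x]]$. A group word $a_1^{\epsilon_1}\cdots a_m^{\epsilon_m}$ ($m\ge0$, $a_i$ letters, $\epsilon_i=\pm1$) is reduced if $a_i=a_{i+1}$ implies $\epsilon_i=\epsilon_{i+1}$ for all $1\le i<m$ (the empty word is identified with $e$ and is reduced). *)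

theory Defs
  imports "HOL-Algebra.Group"
begin

datatype sign = Pos | Neg

datatype (constants: 'c) qterm =
    Var nat
  | Con 'c
  | Op sign "'c qterm" "'c qterm"

abbreviation qop :: "'c qterm \<Rightarrow> 'c qterm \<Rightarrow> 'c qterm"  (infixl "\<triangleleft>" 70)
  where "s \<triangleleft> t \<equiv> Op Pos s t"

abbreviation qop_inv :: "'c qterm \<Rightarrow> 'c qterm \<Rightarrow> 'c qterm"  (infixl "\<triangleleft>\<^sup>-" 70)
  where "s \<triangleleft>\<^sup>- t \<equiv> Op Neg s t"

primrec vars :: "'c qterm \<Rightarrow> nat set" where
  "vars (Var v) = {v}"
| "vars (Con c) = {}"
| "vars (Op e s t) = vars s \<union> vars t"

primrec subst :: "(nat \<Rightarrow> 'c qterm) \<Rightarrow> 'c qterm \<Rightarrow> 'c qterm" where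
  "subst \<sigma> (Var v) = \<sigma> v"
| "subst \<sigma> (Con c) = Con c"
| "subst \<sigma> (Op e s t) = Op e (subst \<sigma> s) (subst \<sigma> t)"

text \<open>\<open>repl c s t\<close> is $t[s/c]$: every occurrence of the constant \<open>c\<close> in \<open>t\<close> is replaced by \<open>s\<close>.\<close>

primrec repl :: "'c \<Rightarrow> 'c qterm \<Rightarrow> 'c qterm \<Rightarrow> 'c qterm" where
  "repl c s (Var v) = Var v"
| "repl c s (Con d) = (if d = c then s else Con d)"
| "repl c s (Op e t u) = Op e (repl c s t) (repl c s u)"

definition closed_terms :: "'c set \<Rightarrow> 'c qterm set" where
  "closed_terms X = {t. constants t \<subseteq> X \<and> vars t = {}}"

definition quandle_axioms :: "('c qterm \<times> 'c qterm) set" where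
  "quandle_axioms =
    (let x = Var 0; y = Var 1; z = Var 2 in
     {((x \<triangleleft> y) \<triangleleft> z, (x \<triangleleft> z) \<triangleleft> (y \<triangleleft> z)),
      ((x \<triangleleft>\<^sup>- y) \<triangleleft>\<^sup>- z, (x \<triangleleft>\<^sup>- z) \<triangleleft>\<^sup>- (y \<triangleleft>\<^sup>- z)),
      ((x \<triangleleft> y) \<triangleleft>\<^sup>- y, x),
      ((x \<triangleleft>\<^sup>- y) \<triangleleft> y, x),
      (x \<triangleleft> x, x),
      (x \<triangleleft>\<^sup>- x, x)})"

text \<open>Derivability in equational logic over the signature with constants \<open>X\<close>; all terms
  occurring in a derivation only use constants from \<open>X\<close>.\<close>

inductive provable :: "'c set \<Rightarrow> 'c qterm \<Rightarrow> 'c qterm \<Rightarrow> bool" for X :: "'c set" where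
  axm: "(s, t) \<in> quandle_axioms \<Longrightarrow> provable X s t"
| refl: "constants t \<subseteq> X \<Longrightarrow> provable X t t"
| sym: "provable X s t \<Longrightarrow> provable X t s"
| trans: "provable X s t \<Longrightarrow> provable X t u \<Longrightarrow> provable X s u"
| cong: "provable X s s' \<Longrightarrow> provable X t t' \<Longrightarrow> provable X (Op e s t) (Op e s' t')"
| inst: "provable X s t \<Longrightarrow> (\<And>v. constants (\<sigma> v) \<subseteq> X)
           \<Longrightarrow> provable X (subst \<sigma> s) (subst \<sigma> t)"

definition prov_eq :: "'c set \<Rightarrow> ('c qterm \<times> 'c qterm) set" where
  "prov_eq X = {(s, t). s \<in> closed_terms X \<and> t \<in> closed_terms X \<and> provable X s t}"

definition tclass :: "'c set \<Rightarrow> 'c qterm \<Rightarrow> 'c qterm set" where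
  "tclass X t = prov_eq X `` {t}"

text \<open>\<open>CX\<close>, \<open>CX0\<close>, \<open>CX1\<close> and \<open>CY i\<close> are the constants $x$, $x_0$, $x_1$ and $y_i$. Only
  the \<open>CY i\<close> with \<open>1 \<le> i \<le> n\<close> are used in the signatures for the free quandle on \<open>n\<close> generators.\<close>

datatype const = CX | CX0 | CX1 | CY nat

definition gens :: "nat \<Rightarrow> const set" where
  "gens n = CY ` {1..n}"

definition invertible_term :: "nat \<Rightarrow> const qterm \<Rightarrow> bool" where
  "invertible_term n t \<longleftrightarrow>
    (\<exists>s \<in> closed_terms (insert CX (gens n)).
       (repl CX s t, Con CX) \<in> prov_eq (insert CX (gens n)) \<and>
       (Con CX, repl CX t s) \<in> prov_eq (insert CX (gens n)))"

definition commutes_generically :: "nat \<Rightarrow> const qterm \<Rightarrow> bool" where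
  "commutes_generically n t \<longleftrightarrow>
    (\<forall>e. (repl CX (Op e (Con CX0) (Con CX1)) t,
           Op e (repl CX (Con CX0) t) (repl CX (Con CX1) t))
          \<in> prov_eq ({CX0, CX1} \<union> gens n))"

text \<open>The logical isotropy group of the free quandle on $y_1,\dots,y_n$. The product of two
  classes is written without choosing representatives: it is the union of the classes of all
  $t[s/x]$ with \<open>t \<in> A\<close> and \<open>s \<in> B\<close>.\<close>

definition isotropy_group :: "nat \<Rightarrow> const qterm set monoid" where
  "isotropy_group n =
    \<lparr>carrier = {tclass (insert CX (gens n)) t | t.
        t \<in> closed_terms (insert CX (gens n)) \<and> invertible_term n t \<and> commutes_generically n t},
     mult = (\<lambda>A B. \<Union>t\<in>A. \<Union>s\<in>B. tclass (insert CX (gens n)) (repl CX s t)),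
     one = tclass (insert CX (gens n)) (Con CX)\<rparr>"

text \<open>A group word $y_{i_1}^{\epsilon_1}\cdots y_{i_m}^{\epsilon_m}$ is the list of the pairs
  $(i_k,\epsilon_k)$.\<close>

definition reduced :: "('a \<times> sign) list \<Rightarrow> bool" where
  "reduced w \<longleftrightarrow>
    (\<forall>k. Suc k < length w \<longrightarrow> fst (w ! k) = fst (w ! Suc k) \<longrightarrow> snd (w ! k) = snd (w ! Suc k))"

text \<open>The left-bracketed term $x\lhd^{\epsilon_1}y_{i_1}\lhd^{\epsilon_2}\cdots\lhd^{\epsilon_m}y_{i_m}$.\<close>

definition word_term :: "(nat \<times> sign) list \<Rightarrow> const qterm" where
  "word_term w = foldl (\<lambda>t (i, e). Op e t (Con (CY i))) (Con CX) w"

end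

theory Submission
  imports Defs
begin

text \<open>Every closed term is provably equal to a constant acted on from the right by a word in the
  constants. For a term \<open>t\<close> over \<open>x, y\<^sub>1, \<dots>, y\<^sub>n\<close> that represents an element of the isotropy group,
  invertibility makes that constant \<open>x\<close>: the projection \<open>a \<lhd> b = a\<close> is a quandle operation that
  remembers it. So \<open>t\<close> is \<open>x\<close> acted on by a word \<open>w(x)\<close>.

  For a group \<open>G\<close>, the disjoint union of the right regular action of \<open>G\<close>, whose elements act
  trivially, and of \<open>G\<close> with conjugation is a quandle. Take \<open>G\<close> free, send \<open>x\<^sub>0\<close> to the unit of the
  regular part, and \<open>x\<^sub>1\<close> and the \<open>y\<^sub>i\<close> to free generators in the conjugation part. Since \<open>x\<^sub>0\<close> acts
  trivially, the commutation law for \<open>t\<close> becomes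
  \<open>x\<^sub>1 w(1) = w(1) w(x\<^sub>1)\<^sup>-\<^sup>1 x\<^sub>1 w(x\<^sub>1)\<close>, so \<open>w(x\<^sub>1) w(1)\<^sup>-\<^sup>1\<close> commutes with the generator \<open>x\<^sub>1\<close> and is a
  power of it. Powers of \<open>x\<close> fix \<open>x\<close>, hence \<open>t\<close> equals \<open>x\<close> acted on by \<open>w(1)\<close>, a word in the \<open>y\<^sub>i\<close>.\<close>

section \<open>Free groups\<close>

primrec flip :: "sign \<Rightarrow> sign" where
  "flip Pos = Neg"
| "flip Neg = Pos"

lemma flip_flip [simp]: "flip (flip e) = e"
  by (cases e) auto

lemma flip_eq_iff: "flip e = e' \<longleftrightarrow> e \<noteq> e'"
  and eq_flip_iff: "e' = flip e \<longleftrightarrow> e' \<noteq> e"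
  by (cases e; cases e'; simp)+

section \<open>Reduced words and normal forms\<close>

type_synonym 'a word = "('a \<times> sign) list"

lemma reduced_iff_successively:
  "reduced w \<longleftrightarrow> successively (\<lambda>p q. fst p = fst q \<longrightarrow> snd p = snd q) w"
  unfolding reduced_def successively_conv_nth by auto

lemma reduced_Nil [simp]: "reduced []"
  by (simp add: reduced_def)

lemma reduced_Cons:
  "reduced (l # w) \<longleftrightarrow> w = [] \<or> (hd w \<noteq> (fst l, flip (snd l)) \<and> reduced w)"
  unfolding reduced_iff_successively successively_Cons
  by (cases l; cases "hd w") (auto simp: flip_eq_iff eq_flip_iff)

lemma reduced_map_apfst:
  assumes "inj f"
  shows "reduced (map (apfst f) w) \<longleftrightarrow> reduced w"
  unfolding reduced_iff_successively successively_map
  using assms by (simp add: inj_eq)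

definition push :: "'a \<times> sign \<Rightarrow> 'a word \<Rightarrow> 'a word" where
  "push l w = (if w \<noteq> [] \<and> hd w = (fst l, flip (snd l)) then tl w else l # w)"

text \<open>Van der Waerden's trick: letters act on reduced words by \<open>push\<close>, and a word
  is applied to the empty word. No confluence argument for cancellation is then needed.\<close>

definition nf :: "'a word \<Rightarrow> 'a word" where
  "nf w = foldr push w []"

lemma nf_Nil [simp]: "nf [] = []"
  and nf_Cons [simp]: "nf (l # w) = push l (nf w)"
  by (simp_all add: nf_def)

lemma reduced_push: "reduced w \<Longrightarrow> reduced (push l w)"
  by (cases w) (auto simp: push_def reduced_Cons)

lemma reduced_nf: "reduced (nf w)"
  by (induction w) (auto simp: reduced_push)

text \<open>Opposite letters act on reduced words as mutually inverse permutations: once the first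
  letter is cancelled, reducedness prevents a second cancellation.\<close>

lemma push_push_flip: "reduced w \<Longrightarrow> push (c, e) (push (c, flip e) w) = w"
  by (cases w) (auto simp: push_def reduced_Cons)

lemma reduced_foldr_push: "reduced v \<Longrightarrow> reduced (foldr push u v)"
  by (induction u) (auto simp: reduced_push)

text \<open>\<open>push l u\<close> is \<open>l # u\<close> up to dropping a cancelling pair, and
  such a pair acts as the identity.\<close>

lemma foldr_push_push:
  assumes "reduced v"
  shows "foldr push (push l u) v = push l (foldr push u v)"
proof (cases "u \<noteq> [] \<and> hd u = (fst l, flip (snd l))")
  case True
  then obtain r where "u = (fst l, flip (snd l)) # r"
    by (cases u) auto
  then show ?thesis
    using push_push_flip[OF reduced_foldr_push[OF assms, of r], of "fst l" "snd l"]
    by (simp add: push_def)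
qed (auto simp: push_def)

lemma foldr_push_nf: "reduced v \<Longrightarrow> foldr push (nf u) v = foldr push u v"
  by (induction u) (auto simp: foldr_push_push)

lemma nf_append: "nf (u @ v) = foldr push u (nf v)"
  by (simp add: nf_def)

lemma nf_reduced: "reduced w \<Longrightarrow> nf w = w"
  by (induction w) (auto simp: push_def reduced_Cons)

text \<open>This gives associativity of the product in the free group: \<open>u\<close> and
  \<open>nf u\<close> act alike on reduced words.\<close>

lemma nf_append_nf: "nf (nf u @ nf v) = nf (u @ v)"
  by (simp add: nf_append foldr_push_nf reduced_nf nf_reduced)

lemma set_nf: "set (nf w) \<subseteq> set w"
proof (induction w)
  case (Cons l w)
  have "set (push l (nf w)) \<subseteq> insert l (set (nf w))"
    by (cases "nf w") (auto simp: push_def)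
  with Cons show ?case by auto
qed simp

lemma length_push: "length (push l w) \<le> Suc (length w)"
  by (auto simp: push_def)

lemma length_nf: "length (nf w) \<le> length w"
  by (induction w) (auto intro: order_trans[OF length_push])

text \<open>Every cancellation shortens the word, so equal length means that none took
  place.\<close>

lemma nf_eq_if_length_eq: "length (nf w) = length w \<Longrightarrow> nf w = w"
proof (induction w)
  case (Cons l w)
  have "length (nf w) = length w"
    using Cons.prems length_push[of l "nf w"] length_nf[of w] by simp
  with Cons.IH have "nf w = w" .
  then show ?case
    using Cons.prems by (auto simp: push_def split: if_splits)
qed simp

definition inv_word :: "'a word \<Rightarrow> 'a word" where
  "inv_word w = rev (map (apsnd flip) w)"

lemma inv_word_inv_word [simp]: "inv_word (inv_word w) = w"
  by (induction w) (auto simp: inv_word_def)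

lemma fst_set_inv_word [simp]: "fst ` set (inv_word w) = fst ` set w"
  by (auto simp: inv_word_def image_image)

lemma nf_inv_word_append: "nf (inv_word w @ w) = []"
proof (induction w)
  case (Cons l w)
  have "push (fst l, flip (snd l)) (push l (nf w)) = nf w"
    using push_push_flip[OF reduced_nf[of w], of "fst l" "flip (snd l)"] by simp
  then have "nf (inv_word (l # w) @ l # w) = nf (inv_word w @ w)"
    by (cases l) (simp add: nf_append inv_word_def)
  with Cons show ?case by simp
qed (simp add: inv_word_def)

section \<open>The free group\<close>

typedef 'a free_group = "{w :: 'a word. reduced w}"
  by (rule exI[of _ "[]"]) simp

setup_lifting type_definition_free_group

lift_definition of_word :: "'a word \<Rightarrow> 'a free_group" is nf
  by (rule reduced_nf)

text \<open>The class \<open>group_add\<close> does not assume commutativity; products are written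
  as sums from here on.\<close>

instantiation free_group :: (type) group_add
begin

lift_definition zero_free_group :: "'a free_group" is "[]"
  by simp

lift_definition plus_free_group :: "'a free_group \<Rightarrow> 'a free_group \<Rightarrow> 'a free_group"
  is "\<lambda>u v. nf (u @ v)"
  by (rule reduced_nf)

lift_definition uminus_free_group :: "'a free_group \<Rightarrow> 'a free_group"
  is "\<lambda>u. nf (inv_word u)"
  by (rule reduced_nf)

definition minus_free_group :: "'a free_group \<Rightarrow> 'a free_group \<Rightarrow> 'a free_group" where
  "minus_free_group g h = g + (- h)"

instance
proof
  fix a b c :: "'a free_group"
  show "a + b + c = a + (b + c)"
  proof transfer
    fix u v w :: "'a word"
    assume "reduced u" "reduced v" "reduced w"
    then show "nf (nf (u @ v) @ w) = nf (u @ nf (v @ w))"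
      using nf_append_nf[of "u @ v" w] nf_append_nf[of u "v @ w"] by (simp add: nf_reduced)
  qed
  show "0 + a = a" "a + 0 = a"
    by (transfer, simp add: nf_reduced)+
  show "- a + a = 0"
  proof transfer
    fix u :: "'a word"
    assume "reduced u"
    then show "nf (nf (inv_word u) @ u) = []"
      using nf_append_nf[of "inv_word u" u] by (simp add: nf_reduced nf_inv_word_append)
  qed
qed (simp add: minus_free_group_def)

end

lemma of_word_Nil [simp]: "of_word [] = 0"
  by transfer simp

lemma of_word_append: "of_word (u @ v) = of_word u + of_word v"
  by transfer (simp add: nf_append_nf)

lemma of_word_eq_iff: "of_word u = of_word v \<longleftrightarrow> nf u = nf v"
  by transfer simp

lemma of_word_inv_word: "of_word (inv_word w) = - of_word w"
proof -
  have "of_word (inv_word w) + of_word w = of_word []"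
    unfolding of_word_append[symmetric] of_word_eq_iff by (simp add: nf_inv_word_append)
  then show ?thesis
    by (simp add: eq_neg_iff_add_eq_0)
qed

definition gen :: "'a \<Rightarrow> 'a free_group" where
  "gen c = of_word [(c, Pos)]"

definition sgn_of :: "sign \<Rightarrow> 'g::group_add \<Rightarrow> 'g" where
  "sgn_of e g = (case e of Pos \<Rightarrow> g | Neg \<Rightarrow> - g)"

lemma of_word_singleton: "of_word [(c, e)] = sgn_of e (gen c)"
  using of_word_inv_word[of "[(c, Pos)]"]
  by (cases e) (simp_all add: gen_def sgn_of_def inv_word_def)

lemma of_word_eq_sum_list: "of_word w = sum_list (map (\<lambda>(c, e). sgn_of e (gen c)) w)"
proof (induction w)
  case (Cons l w)
  then show ?case
    using of_word_append[of "[l]" w] by (cases l) (simp add: of_word_singleton)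
qed simp

section \<open>Centralizer of a free generator\<close>

lemma commutes_sgn_of:
  fixes g :: "'g::group_add"
  shows "g + sgn_of e g = sgn_of e g + g"
  by (cases e) (simp_all add: sgn_of_def)

text \<open>The assumption says that \<open>a\<close> and \<open>b\<close> conjugate
  \<open>g\<close> to the same element, so their quotient centralizes \<open>g\<close>.\<close>

lemma commutes_if_conj_eq:
  fixes a b g :: "'g::group_add"
  assumes "g + b = b + (- a + g + a)"
  shows "g + (a - b) = (a - b) + g"
proof -
  have "(a - b) + g = (a + (- b + (g + b))) - b"
    by (simp only: diff_conv_add_uminus add.assoc right_minus add_0_right)
  also have "a + (- b + (g + b)) = g + a"
    unfolding assms by (simp add: add.assoc del: add_uminus_conv_diff)
  finally show ?thesis
    by (simp add: add_diff_eq)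
qed

text \<open>If a reduced word \<open>w\<close> starts with another letter than \<open>c\<close>, then \<open>c w\<close> is reduced and is
  therefore the only word of length at most \<open>|w| + 1\<close> for its group element; but \<open>w c\<close> differs
  from it in the first letter.\<close>

lemma centralizer_gen_reduced:
  assumes "reduced w" "gen c + of_word w = of_word w + gen c"
  shows "fst ` set w \<subseteq> {c}"
  using assms
proof (induction w)
  case (Cons l w)
  obtain d e where l: "l = (d, e)" by (cases l)
  have red: "reduced w"
    using Cons.prems(1) by (auto simp: reduced_Cons)
  show ?case
  proof (cases "d = c")
    case True
    let ?l = "sgn_of e (gen c)"
    have "of_word (l # w) = ?l + of_word w"
      using of_word_append[of "[l]" w] by (simp add: l True of_word_singleton)
    then have "gen c + (?l + of_word w) = ?l + of_word w + gen c"
      using Cons.prems(2) by simp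
    \<comment> \<open>The first letter is a power of \<open>gen c\<close> and commutes with it, so
      it can be cancelled on the left and the tail commutes with \<open>gen c\<close> too.\<close>
    then have "?l + (gen c + of_word w) = ?l + (of_word w + gen c)"
      by (metis add.assoc commutes_sgn_of)
    then have "gen c + of_word w = of_word w + gen c"
      by simp
    from Cons.IH[OF red this] show ?thesis
      by (simp add: l True)
  next
    case False
    have "nf ((c, Pos) # l # w) = nf ((l # w) @ [(c, Pos)])"
      using Cons.prems(2) of_word_append[of "[(c, Pos)]" "l # w"]
      unfolding gen_def of_word_append[symmetric] of_word_eq_iff by simp
    moreover have "nf ((c, Pos) # l # w) = (c, Pos) # l # w"
      using Cons.prems(1) False by (intro nf_reduced) (simp add: reduced_Cons[of "(c, Pos)"] l)
    ultimately have eq: "nf ((l # w) @ [(c, Pos)]) = (c, Pos) # l # w"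
      by simp
    then have "nf ((l # w) @ [(c, Pos)]) = (l # w) @ [(c, Pos)]"
      by (intro nf_eq_if_length_eq) simp
    with eq False show ?thesis
      by (simp add: l)
  qed
qed simp

lemma centralizer_gen:
  assumes "gen c + of_word w = of_word w + gen c"
  shows "fst ` set (nf w) \<subseteq> {c}"
proof (rule centralizer_gen_reduced[OF reduced_nf])
  have "of_word (nf w) = of_word w"
    by (simp add: of_word_eq_iff nf_reduced reduced_nf)
  with assms show "gen c + of_word (nf w) = of_word (nf w) + gen c"
    by simp
qed

section \<open>Quandle models\<close>

definition is_quandle :: "(sign \<Rightarrow> 'm \<Rightarrow> 'm \<Rightarrow> 'm) \<Rightarrow> bool" where
  "is_quandle f \<longleftrightarrow>
    (\<forall>e x y z. f e (f e x y) z = f e (f e x z) (f e y z)) \<and>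
    (\<forall>e x y. f (flip e) (f e x y) y = x) \<and>
    (\<forall>e x. f e x x = x)"

primrec interp :: "(sign \<Rightarrow> 'm \<Rightarrow> 'm \<Rightarrow> 'm) \<Rightarrow> (nat \<Rightarrow> 'm) \<Rightarrow> ('c \<Rightarrow> 'm) \<Rightarrow> 'c qterm \<Rightarrow> 'm" where
  "interp f \<nu> \<rho> (Var v) = \<nu> v"
| "interp f \<nu> \<rho> (Con c) = \<rho> c"
| "interp f \<nu> \<rho> (Op e s t) = f e (interp f \<nu> \<rho> s) (interp f \<nu> \<rho> t)"

lemma interp_subst: "interp f \<nu> \<rho> (subst \<sigma> t) = interp f (\<lambda>v. interp f \<nu> \<rho> (\<sigma> v)) \<rho> t"
  by (induction t) auto

lemma interp_repl: "interp f \<nu> \<rho> (repl c s t) = interp f \<nu> (\<rho>(c := interp f \<nu> \<rho> s)) t"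
  by (induction t) auto

lemma interp_quandle_axioms:
  assumes "is_quandle f" "(s, t) \<in> quandle_axioms"
  shows "interp f \<nu> \<rho> s = interp f \<nu> \<rho> t"
proof -
  have "f e (f e x y) z = f e (f e x z) (f e y z)" "f (flip e) (f e x y) y = x" "f e x x = x"
    for e x y z
    using assms(1) unfolding is_quandle_def by blast+
  note laws = this(1)[of Pos] this(1)[of Neg] this(2)[of Pos] this(2)[of Neg] this(3)
  from assms(2) show ?thesis
    unfolding quandle_axioms_def Let_def using laws by auto
qed

lemma provable_sound:
  assumes "provable X s t" "is_quandle f"
  shows "interp f \<nu> \<rho> s = interp f \<nu> \<rho> t"
  using assms(1)
  \<comment> \<open>The valuation varies because \<open>inst\<close> evaluates its premise at the
    values of the substituted terms.\<close>
  by (induction arbitrary: \<nu>) (auto simp: interp_subst interp_quandle_axioms[OF assms(2)])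

lemma is_quandle_proj: "is_quandle (\<lambda>e x y. x)"
  by (simp add: is_quandle_def)

text \<open>\<open>Inl\<close> carries the regular action, on which the unit of the group is the weight of every
  element; \<open>Inr\<close> carries conjugation.\<close>

primrec weight :: "'g::group_add + 'g \<Rightarrow> 'g" where
  "weight (Inl g) = 0"
| "weight (Inr h) = h"

primrec translate :: "'g::group_add + 'g \<Rightarrow> 'g \<Rightarrow> 'g + 'g" where
  "translate (Inl g) a = Inl (g + a)"
| "translate (Inr h) a = Inr (- a + h + a)"

text \<open>An augmented quandle: the group acts by \<open>translate\<close>, and \<open>k\<close>
  acts through its augmentation \<open>weight k\<close>.\<close>

definition reg_conj :: "sign \<Rightarrow> 'g::group_add + 'g \<Rightarrow> 'g + 'g \<Rightarrow> 'g + 'g" where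
  "reg_conj e m k = translate m (sgn_of e (weight k))"

lemma translate_0 [simp]: "translate m 0 = m"
  by (cases m) auto

lemma translate_add: "translate m (a + b) = translate (translate m a) b"
  by (cases m) (simp_all add: add.assoc minus_add del: add_uminus_conv_diff)

lemma weight_translate: "weight (translate m a) = - a + weight m + a"
  by (cases m) auto

lemma sgn_of_conj:
  fixes a g :: "'g::group_add"
  shows "sgn_of e (- a + g + a) = - a + sgn_of e g + a"
  by (cases e) (auto simp: sgn_of_def minus_add add.assoc)

text \<open>Self-distributivity is the equivariance of \<open>weight\<close> under conjugation;
  idempotence holds because each element is fixed by its own weight.\<close>

lemma is_quandle_reg_conj: "is_quandle reg_conj"
  unfolding is_quandle_def
proof (intro conjI allI)
  fix e and x y z :: "'a + 'a"
  show "reg_conj e (reg_conj e x y) z = reg_conj e (reg_conj e x z) (reg_conj e y z)"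
    unfolding reg_conj_def weight_translate sgn_of_conj translate_add[symmetric]
    by (simp add: add.assoc[symmetric])
  have "sgn_of e (weight y) + sgn_of (flip e) (weight y) = 0"
    by (cases e) (auto simp: sgn_of_def)
  then show "reg_conj (flip e) (reg_conj e x y) y = x"
    unfolding reg_conj_def translate_add[symmetric] by simp
  show "reg_conj e x x = x"
    by (cases x; cases e) (auto simp: reg_conj_def sgn_of_def)
qed

section \<open>Words acting on terms\<close>

definition act :: "'c qterm \<Rightarrow> 'c word \<Rightarrow> 'c qterm" where
  "act s w = foldl (\<lambda>t (c, e). Op e t (Con c)) s w"

lemma act_Nil [simp]: "act s [] = s"
  and act_Cons [simp]: "act s ((c, e) # w) = act (Op e s (Con c)) w"
  and act_append: "act s (u @ v) = act (act s u) v"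
  by (simp_all add: act_def)

lemma constants_act: "constants (act s w) = constants s \<union> fst ` set w"
  by (induction w arbitrary: s) force+

lemma vars_act [simp]: "vars (act s w) = vars s"
  by (induction w arbitrary: s) auto

lemma act_in_closed_terms:
  "s \<in> closed_terms X \<Longrightarrow> fst ` set w \<subseteq> X \<Longrightarrow> act s w \<in> closed_terms X"
  by (simp add: closed_terms_def constants_act)

lemma repl_act: "c \<notin> fst ` set w \<Longrightarrow> repl c r (act s w) = act (repl c r s) w"
  by (induction w arbitrary: s) auto

lemma interp_act:
  "interp reg_conj \<nu> \<rho> (act s w) =
    translate (interp reg_conj \<nu> \<rho> s) (sum_list (map (\<lambda>(c, e). sgn_of e (weight (\<rho> c))) w))"
  by (induction w arbitrary: s) (auto simp: reg_conj_def translate_add)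

section \<open>Derived identities and the action of words\<close>

lemma provable_inst3:
  assumes "(l, r) \<in> quandle_axioms"
    and "constants a \<subseteq> X" "constants b \<subseteq> X" "constants c \<subseteq> X"
  shows "provable X (subst (\<lambda>v. if v = 0 then a else if v = 1 then b else c) l)
    (subst (\<lambda>v. if v = 0 then a else if v = 1 then b else c) r)"
  by (rule provable.inst[OF provable.axm[OF assms(1)]]) (use assms(2-) in auto)

lemma provable_dist:
  assumes "constants a \<subseteq> X" "constants b \<subseteq> X" "constants c \<subseteq> X"
  shows "provable X (Op e (Op e a b) c) (Op e (Op e a c) (Op e b c))"
  using provable_inst3[OF _ assms,
      of "Op e (Op e (Var 0) (Var 1)) (Var 2)"
        "Op e (Op e (Var 0) (Var 2)) (Op e (Var 1) (Var 2))"]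
  by (cases e) (auto simp: quandle_axioms_def Let_def)

lemma provable_cancel:
  assumes "constants a \<subseteq> X" "constants b \<subseteq> X"
  shows "provable X (Op (flip e) (Op e a b) b) a"
  using provable_inst3[OF _ assms assms(2), of "Op (flip e) (Op e (Var 0) (Var 1)) (Var 1)" "Var 0"]
  by (cases e) (auto simp: quandle_axioms_def Let_def)

lemma provable_cancel':
  assumes "constants a \<subseteq> X" "constants b \<subseteq> X"
  shows "provable X (Op e (Op (flip e) a b) b) a"
  using provable_cancel[OF assms, of "flip e"] by simp

lemma provable_idem:
  assumes "constants a \<subseteq> X"
  shows "provable X (Op e a a) a"
  using provable_inst3[OF _ assms assms assms, of "Op e (Var 0) (Var 0)" "Var 0"]
  by (cases e) (auto simp: quandle_axioms_def Let_def)

text \<open>For opposite signs, write \<open>a\<close> and \<open>b\<close> as images under the inverse of the action of \<open>c\<close> and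
  use the axiom for \<open>e'\<close>.\<close>

lemma provable_dist_mixed:
  assumes "constants a \<subseteq> X" "constants b \<subseteq> X" "constants c \<subseteq> X"
  shows "provable X (Op e (Op e' a b) c) (Op e' (Op e a c) (Op e b c))"
proof (cases "e = e'")
  case True
  with provable_dist[OF assms] show ?thesis by simp
next
  case False
  then have e': "e' = flip e"
    by (metis flip_eq_iff)
  let ?a = "Op e a c" and ?b = "Op e b c"
  have X: "constants ?a \<subseteq> X" "constants ?b \<subseteq> X" "constants (Op e' ?a ?b) \<subseteq> X"
    using assms by auto
  have "provable X a (Op e' ?a c)" "provable X b (Op e' ?b c)"
    unfolding e' by (intro provable.sym[OF provable_cancel] assms)+
  from provable.cong[OF this] have "provable X (Op e' a b) (Op e' (Op e' ?a c) (Op e' ?b c))" .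
  moreover have "provable X (Op e' (Op e' ?a c) (Op e' ?b c)) (Op e' (Op e' ?a ?b) c)"
    by (intro provable.sym[OF provable_dist] X assms)
  ultimately have "provable X (Op e' a b) (Op e' (Op e' ?a ?b) c)"
    by (rule provable.trans)
  then have "provable X (Op e (Op e' a b) c) (Op e (Op e' (Op e' ?a ?b) c) c)"
    by (rule provable.cong) (use assms in \<open>auto intro: provable.refl\<close>)
  moreover have "provable X (Op e (Op e' (Op e' ?a ?b) c) c) (Op e' ?a ?b)"
    using provable_cancel'[OF X(3) assms(3)] unfolding e' .
  ultimately show ?thesis
    by (rule provable.trans)
qed

lemma provable_act_cong:
  assumes "provable X s t" "fst ` set w \<subseteq> X"
  shows "provable X (act s w) (act t w)"
  using assms
proof (induction w arbitrary: s t)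
  case (Cons l w)
  obtain c e where l: "l = (c, e)" by (cases l)
  have "provable X (Op e s (Con c)) (Op e t (Con c))"
    by (rule provable.cong) (use Cons.prems l in \<open>auto intro: provable.refl\<close>)
  with Cons show ?case by (simp add: l)
qed simp

text \<open>Each letter acts as an endomorphism of both operations by
  \<open>provable_dist_mixed\<close>, hence so does a word. Generic commutation of word terms rests
  on this.\<close>

lemma provable_act_Op:
  assumes "constants s \<subseteq> X" "constants t \<subseteq> X" "fst ` set w \<subseteq> X"
  shows "provable X (act (Op e s t) w) (Op e (act s w) (act t w))"
  using assms
proof (induction w arbitrary: s t)
  case Nil
  then show ?case by (simp add: provable.refl)
next
  case (Cons l w)
  obtain c d where l: "l = (c, d)" by (cases l)
  have "provable X (act (Op d (Op e s t) (Con c)) w) (act (Op e (Op d s (Con c)) (Op d t (Con c))) w)"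
    by (intro provable_act_cong provable_dist_mixed) (use Cons.prems l in auto)
  moreover have "provable X \<dots> (Op e (act (Op d s (Con c)) w) (act (Op d t (Con c)) w))"
    by (intro Cons.IH) (use Cons.prems l in auto)
  ultimately show ?case
    by (auto simp: l intro: provable.trans)
qed

lemma provable_act_push:
  assumes "constants s \<subseteq> X" "fst l \<in> X" "fst ` set w \<subseteq> X"
  shows "provable X (act s (l # w)) (act s (push l w))"
proof (cases "w \<noteq> [] \<and> hd w = (fst l, flip (snd l))")
  case True
  then obtain r where w: "w = (fst l, flip (snd l)) # r"
    by (cases w) auto
  have "provable X (act (Op (flip (snd l)) (Op (snd l) s (Con (fst l))) (Con (fst l))) r) (act s r)"
    by (intro provable_act_cong provable_cancel) (use assms w in auto)
  then show ?thesis
    by (cases l) (simp add: w push_def)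
next
  case False
  then have "push l w = l # w"
    by (auto simp: push_def)
  then show ?thesis
    using assms by (simp add: constants_act provable.refl)
qed

lemma provable_act_nf:
  assumes "constants s \<subseteq> X" "fst ` set w \<subseteq> X"
  shows "provable X (act s w) (act s (nf w))"
  using assms
proof (induction w arbitrary: s)
  case Nil
  then show ?case by (simp add: provable.refl)
next
  case (Cons l w)
  obtain c e where l: "l = (c, e)" by (cases l)
  have "provable X (act (Op e s (Con c)) w) (act (Op e s (Con c)) (nf w))"
    by (intro Cons.IH) (use Cons.prems l in auto)
  then have "provable X (act s (l # w)) (act s (l # nf w))"
    by (simp add: l)
  moreover have "provable X (act s (l # nf w)) (act s (push l (nf w)))"
    by (intro provable_act_push) (use Cons.prems set_nf[of w] in auto)
  ultimately show ?case
    by (auto intro: provable.trans)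
qed

text \<open>The way back from the free group to provability: both words can be reduced to their
  common normal form.\<close>

lemma provable_act_eq_if_nf_eq:
  assumes "constants s \<subseteq> X" "fst ` set u \<subseteq> X" "fst ` set v \<subseteq> X" "nf u = nf v"
  shows "provable X (act s u) (act s v)"
  using provable_act_nf[OF assms(1,2)] provable_act_nf[OF assms(1,3)] assms(4)
  by (metis provable.sym provable.trans)

lemma provable_act_self:
  assumes "c \<in> X" "fst ` set w \<subseteq> {c}"
  shows "provable X (act (Con c) w) (Con c)"
  using assms(2)
proof (induction w)
  case Nil
  then show ?case using assms(1) by (auto intro: provable.refl)
next
  case (Cons l w)
  obtain e where l: "l = (c, e)" using Cons.prems by (cases l) auto
  have "provable X (act (Op e (Con c) (Con c)) w) (act (Con c) w)"
    by (intro provable_act_cong provable_idem) (use assms(1) Cons.prems in auto)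
  with Cons show ?case by (auto simp: l intro: provable.trans)
qed

text \<open>The values at \<open>Var\<close> are junk: only closed terms matter.\<close>

primrec head :: "'c qterm \<Rightarrow> 'c" where
  "head (Var v) = undefined"
| "head (Con c) = c"
| "head (Op e s t) = head s"

primrec trail :: "'c qterm \<Rightarrow> 'c word" where
  "trail (Var v) = []"
| "trail (Con c) = []"
| "trail (Op e s t) = trail s @ inv_word (trail t) @ [(head t, e)] @ trail t"

lemma head_in_constants: "vars t = {} \<Longrightarrow> head t \<in> constants t"
  by (induction t) auto

lemma fst_set_trail: "vars t = {} \<Longrightarrow> fst ` set (trail t) \<subseteq> constants t"
  by (induction t) (auto simp: image_Un head_in_constants)

lemma head_eq_interp: "head t = interp (\<lambda>e x y. x) (\<lambda>v. undefined) id t"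
  by (induction t) auto

lemma provable_head_eq: "provable X s t \<Longrightarrow> head s = head t"
  unfolding head_eq_interp by (rule provable_sound[OF _ is_quandle_proj])

lemma head_repl: "head t \<noteq> c \<Longrightarrow> vars t = {} \<Longrightarrow> head (repl c s t) = head t"
  by (induction t) auto

text \<open>If \<open>t\<close> is the constant \<open>b\<close> acted on by \<open>w\<close>, then
  acting by \<open>t\<close> is acting by the conjugate of \<open>b\<close> by \<open>w\<close>:
  undo \<open>w\<close>, apply \<open>b\<close>, and let \<open>w\<close> distribute over the
  result.\<close>

lemma provable_act_head_trail:
  assumes "t \<in> closed_terms X"
  shows "provable X t (act (Con (head t)) (trail t))"
  using assms
proof (induction t)
  case (Var v)
  then show ?case by (simp add: closed_terms_def)
next
  case (Con c)
  then show ?case by (auto simp: closed_terms_def intro: provable.refl)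
next
  case (Op e s t)
  then have cl: "s \<in> closed_terms X" "t \<in> closed_terms X"
    by (auto simp: closed_terms_def)
  then have X: "constants s \<subseteq> X" "constants t \<subseteq> X" "head s \<in> X" "head t \<in> X"
    "fst ` set (trail s) \<subseteq> X" "fst ` set (trail t) \<subseteq> X"
    using fst_set_trail[of s] fst_set_trail[of t] head_in_constants[of s] head_in_constants[of t]
    by (auto simp: closed_terms_def)
  let ?s = "act (Con (head s)) (trail s)"
  let ?s' = "act ?s (inv_word (trail t))"
  let ?t = "act (Con (head t)) (trail t)"
  have Xs: "constants ?s \<subseteq> X" "constants ?s' \<subseteq> X" "constants ?t \<subseteq> X"
    using X by (auto simp: constants_act simp flip: image_Un)
  have "provable X (act (Op e ?s' (Con (head t))) (trail t)) (Op e (act ?s' (trail t)) ?t)"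
    by (intro provable_act_Op) (use X Xs in auto)
  moreover have "provable X (act ?s (inv_word (trail t) @ trail t)) (act ?s [])"
    by (intro provable_act_eq_if_nf_eq) (use X Xs in \<open>auto simp: image_Un nf_inv_word_append\<close>)
  then have "provable X (Op e (act ?s' (trail t)) ?t) (Op e ?s ?t)"
    by (intro provable.cong provable.refl) (use Xs in \<open>auto simp: act_append\<close>)
  moreover have "provable X (Op e ?s ?t) (Op e s t)"
    by (intro provable.cong provable.sym[OF Op.IH(1)] provable.sym[OF Op.IH(2)] cl)
  ultimately have "provable X (act (Op e ?s' (Con (head t))) (trail t)) (Op e s t)"
    by (metis provable.trans)
  then show ?case
    by (simp add: act_append provable.sym)
qed

lemma tclass_eq_iff:
  assumes "s \<in> closed_terms X" "t \<in> closed_terms X"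
  shows "tclass X s = tclass X t \<longleftrightarrow> provable X s t"
proof
  assume "tclass X s = tclass X t"
  moreover have "t \<in> tclass X t"
    using assms by (auto simp: tclass_def prov_eq_def closed_terms_def intro: provable.refl)
  ultimately show "provable X s t"
    by (auto simp: tclass_def prov_eq_def)
next
  assume "provable X s t"
  then show "tclass X s = tclass X t"
    using assms by (auto simp: tclass_def prov_eq_def intro: provable.trans provable.sym)
qed

section \<open>The isotropy group\<close>

lemma word_term_eq_act: "word_term w = act (Con CX) (map (apfst CY) w)"
  by (simp add: word_term_def act_def foldl_map case_prod_unfold)

lemma const_notin_gens [simp]: "CX \<notin> gens n" "CX0 \<notin> gens n" "CX1 \<notin> gens n"
  by (auto simp: gens_def)

text \<open>No letter of \<open>w\<close> is \<open>CX\<close>, so substituting for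
  \<open>CX\<close> composes actions, and the inverse word yields the inverse term.\<close>

lemma invertible_term_act:
  assumes "fst ` set w \<subseteq> gens n"
  shows "invertible_term n (act (Con CX) w)"
  unfolding invertible_term_def
proof (intro bexI conjI)
  let ?X = "insert CX (gens n)"
  have w: "fst ` set w \<subseteq> ?X" "CX \<notin> fst ` set w"
    using assms by auto
  have cl: "Con CX \<in> closed_terms ?X"
    by (simp add: closed_terms_def)
  show s: "act (Con CX) (inv_word w) \<in> closed_terms ?X"
    by (intro act_in_closed_terms cl) (simp add: w)
  have inv: "provable ?X (act (Con CX) (inv_word u @ u)) (Con CX)" if "fst ` set u \<subseteq> ?X" for u
    using provable_act_eq_if_nf_eq[of "Con CX" ?X "inv_word u @ u" "[]"] that
    by (simp add: image_Un nf_inv_word_append)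
  have "repl CX (act (Con CX) (inv_word w)) (act (Con CX) w) = act (Con CX) (inv_word w @ w)"
    using w by (simp add: repl_act act_append)
  then show "(repl CX (act (Con CX) (inv_word w)) (act (Con CX) w), Con CX) \<in> prov_eq ?X"
    using inv[of w] w cl by (simp add: prov_eq_def image_Un act_in_closed_terms)
  have "repl CX (act (Con CX) w) (act (Con CX) (inv_word w)) = act (Con CX) (w @ inv_word w)"
    using w by (simp add: repl_act act_append)
  then show "(Con CX, repl CX (act (Con CX) w) (act (Con CX) (inv_word w))) \<in> prov_eq ?X"
    using inv[of "inv_word w"] w cl
    by (simp add: prov_eq_def image_Un act_in_closed_terms provable.sym)
qed

lemma commutes_generically_act:
  assumes "fst ` set w \<subseteq> gens n"
  shows "commutes_generically n (act (Con CX) w)"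
proof -
  let ?Y = "{CX0, CX1} \<union> gens n"
  have Y: "fst ` set w \<subseteq> ?Y" "CX \<notin> fst ` set w"
    using assms by auto
  have "provable ?Y (act (Op e (Con CX0) (Con CX1)) w) (Op e (act (Con CX0) w) (act (Con CX1) w))" for e
    by (intro provable_act_Op) (use Y in auto)
  then show ?thesis
    unfolding commutes_generically_def prov_eq_def closed_terms_def
    using Y by (auto simp: repl_act constants_act)
qed

section \<open>Elements of the group come from words in the \<open>y_i\<close>\<close>

text \<open>A leftmost constant other than \<open>CX\<close> would survive substitution for
  \<open>CX\<close>, but provable equality preserves the leftmost constant.\<close>

lemma head_if_invertible_term:
  assumes "t \<in> closed_terms (insert CX (gens n))" "invertible_term n t"
  shows "head t = CX"
proof (rule ccontr)
  assume "head t \<noteq> CX"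
  obtain s where "provable (insert CX (gens n)) (repl CX s t) (Con CX)"
    using assms(2) by (auto simp: invertible_term_def prov_eq_def)
  then have "head (repl CX s t) = CX"
    by (auto dest: provable_head_eq)
  with \<open>head t \<noteq> CX\<close> head_repl[of t CX s] assms(1) show False
    by (simp add: closed_terms_def)
qed

lemma commutes_generically_centralizes:
  assumes t: "provable (insert CX (gens n)) t (act (Con CX) w)"
    and w: "fst ` set w \<subseteq> insert CX (gens n)"
    and comm: "commutes_generically n t"
  defines "w1 \<equiv> filter (\<lambda>l. fst l \<noteq> CX) w"
  shows "gen CX + of_word (w @ inv_word w1) = of_word (w @ inv_word w1) + gen CX"
proof -
  \<comment> \<open>The free generator \<open>gen CX\<close> serves as the value of
    \<open>CX1\<close>; evaluating \<open>w\<close> with \<open>CX\<close> at that value then gives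
    \<open>of_word w\<close> itself.\<close>
  define \<rho> :: "const \<Rightarrow> const free_group + const free_group" where
    "\<rho> = (\<lambda>c. Inr (gen c))(CX0 := Inl 0, CX1 := Inr (gen CX))"
  define ev where "ev = interp reg_conj (\<lambda>v. Inl 0) \<rho>"
  define ew where "ew m = sum_list (map (\<lambda>(c, e). sgn_of e (weight ((\<rho>(CX := m)) c))) w)" for m
  have ev_repl: "ev (repl CX s t) = translate (ev s) (ew (ev s))" for s
    unfolding ev_def interp_repl provable_sound[OF t is_quandle_reg_conj] interp_act ew_def by simp
  have "c \<noteq> CX0" "c \<noteq> CX1" if "(c, e) \<in> set w" for c e
    using imageI[OF that, of fst] w by auto
  then have "ew (Inr (gen CX)) = of_word w"
    unfolding ew_def of_word_eq_sum_list \<rho>_def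
    by (intro arg_cong[of _ _ sum_list] map_cong) auto
  \<comment> \<open>An \<open>Inl\<close> value has weight zero, which erases the letters
    \<open>CX\<close> from \<open>w\<close>.\<close>
  moreover have "ew (Inl g) = of_word w1" for g
    unfolding ew_def w1_def using w
  proof (induction w)
    case (Cons l w)
    obtain c e where l: "l = (c, e)" by (cases l)
    have "sgn_of e (0 :: const free_group) = 0"
      by (cases e) (auto simp: sgn_of_def)
    moreover have "c \<noteq> CX0" "c \<noteq> CX1"
      using Cons.prems l by auto
    ultimately show ?case
      using Cons by (auto simp: l \<rho>_def of_word_eq_sum_list)
  qed simp
  ultimately have ew: "ew (Inr (gen CX)) = of_word w" "\<And>g. ew (Inl g) = of_word w1" .
  have ev_ops: "ev (Con CX0) = Inl 0" "ev (Con CX1) = Inr (gen CX)"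
    "\<And>e s u. ev (Op e s u) = reg_conj e (ev s) (ev u)"
    by (auto simp: ev_def \<rho>_def)
  have "provable ({CX0, CX1} \<union> gens n) (repl CX (Con CX0 \<triangleleft> Con CX1) t)
      (repl CX (Con CX0) t \<triangleleft> repl CX (Con CX1) t)"
    using comm by (auto simp: commutes_generically_def prov_eq_def)
  then have "ev (repl CX (Con CX0 \<triangleleft> Con CX1) t) = ev (repl CX (Con CX0) t \<triangleleft> repl CX (Con CX1) t)"
    unfolding ev_def by (rule provable_sound[OF _ is_quandle_reg_conj])
  \<comment> \<open>Both values lie in the regular part, where equality is equality of group
    elements.\<close>
  then have "gen CX + of_word w1 = of_word w1 + (- of_word w + gen CX + of_word w)"
    unfolding ev_ops ev_repl by (simp add: reg_conj_def sgn_of_def ew)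
  from commutes_if_conj_eq[OF this] show ?thesis
    by (simp add: of_word_append of_word_inv_word)
qed

lemma provable_word_term_if_isotropy:
  assumes t: "t \<in> closed_terms (insert CX (gens n))"
    and "invertible_term n t" and comm: "commutes_generically n t"
  obtains w where "\<forall>(i, e) \<in> set w. 1 \<le> i \<and> i \<le> n" "reduced w"
    "provable (insert CX (gens n)) t (word_term w)"
proof -
  let ?X = "insert CX (gens n)"
  define w where "w = trail t"
  define w1 where "w1 = filter (\<lambda>l. fst l \<noteq> CX) w"
  let ?g = "w @ inv_word w1"
  have w: "fst ` set w \<subseteq> ?X"
    using t fst_set_trail[of t] by (auto simp: closed_terms_def w_def)
  then have w1: "fst ` set w1 \<subseteq> gens n"
    by (auto simp: w1_def)
  have tw: "provable ?X t (act (Con CX) w)"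
    using provable_act_head_trail[OF t] head_if_invertible_term[OF t assms(2)] by (simp add: w_def)
  have g: "fst ` set ?g \<subseteq> ?X"
    using w w1 by (auto simp only: set_append image_Un fst_set_inv_word)
  \<comment> \<open>In the free group \<open>w\<close> is \<open>?g\<close> followed by
    \<open>w1\<close>. The factor \<open>?g\<close> is a power of \<open>CX\<close> and fixes
    \<open>CX\<close>, which leaves \<open>w1\<close>.\<close>
  have "provable ?X (act (Con CX) ?g) (act (Con CX) (nf ?g))"
    by (intro provable_act_nf) (use g in auto)
  moreover have "provable ?X (act (Con CX) (nf ?g)) (Con CX)"
    using commutes_generically_centralizes[OF tw w comm]
    by (intro provable_act_self centralizer_gen) (auto simp: w1_def)
  ultimately have "provable ?X (act (Con CX) ?g) (Con CX)"
    by (rule provable.trans)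
  then have "provable ?X (act (Con CX) (?g @ w1)) (act (Con CX) w1)"
    unfolding act_append[of _ ?g] by (rule provable_act_cong) (use w1 in auto)
  moreover have "nf w = nf (?g @ w1)"
    unfolding of_word_eq_iff[symmetric] by (simp add: of_word_append of_word_inv_word add.assoc)
  then have "provable ?X (act (Con CX) w) (act (Con CX) (?g @ w1))"
    by (intro provable_act_eq_if_nf_eq) (use w w1 g in \<open>auto simp only: set_append image_Un\<close>, auto)
  moreover have "provable ?X (act (Con CX) w1) (act (Con CX) (nf w1))"
    by (intro provable_act_nf) (use w1 in auto)
  ultimately have t_nf: "provable ?X t (act (Con CX) (nf w1))"
    using tw by (metis provable.trans)
  have "fst ` set (nf w1) \<subseteq> CY ` {1..n}"
    using set_nf[of w1] w1 by (auto simp: gens_def)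
  \<comment> \<open>Membership in \<open>lists\<close> of an image lets \<open>lists_image\<close>
    produce a word \<open>v\<close> of indices all at once.\<close>
  then have "nf w1 \<in> lists (apfst CY ` ({1..n} \<times> UNIV))"
    by (force simp: in_lists_conv_set image_iff)
  then obtain v where v: "set v \<subseteq> {1..n} \<times> UNIV" "nf w1 = map (apfst CY) v"
    by (auto simp: lists_image)
  show thesis
  proof
    show "\<forall>(i, e) \<in> set v. 1 \<le> i \<and> i \<le> n"
      using v(1) by auto
    show "reduced v"
      using reduced_nf[of w1] v(2) reduced_map_apfst[of CY v] by (simp add: inj_def)
    show "provable ?X t (word_term v)"
      using t_nf v(2) by (simp add: word_term_eq_act)
  qed
qed

theorem theorem3p4:
  fixes n :: nat and t :: "const qterm"
  assumes "t \<in> closed_terms (insert CX (gens n))"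
  shows "tclass (insert CX (gens n)) t \<in> carrier (isotropy_group n) \<longleftrightarrow>
    (\<exists>w :: (nat \<times> sign) list.
       (\<forall>(i, e) \<in> set w. 1 \<le> i \<and> i \<le> n) \<and>
       tclass (insert CX (gens n)) t = tclass (insert CX (gens n)) (word_term w) \<and>
       reduced w)"
proof -
  let ?X = "insert CX (gens n)"
  have letters: "fst ` set (map (apfst CY) w) \<subseteq> gens n"
    if "\<forall>(i, e) \<in> set w. 1 \<le> i \<and> i \<le> n" for w :: "nat word"
    using that by (auto simp: gens_def)
  have closed: "word_term w \<in> closed_terms ?X"
    if "\<forall>(i, e) \<in> set w. 1 \<le> i \<and> i \<le> n" for w
    unfolding word_term_eq_act using letters[OF that]
    by (intro act_in_closed_terms) (auto simp: closed_terms_def)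
  show ?thesis
  proof
    assume "tclass ?X t \<in> carrier (isotropy_group n)"
    \<comment> \<open>The carrier only supplies some representative \<open>t'\<close> of the class,
      possibly different from \<open>t\<close>.\<close>
    then obtain t' where t': "tclass ?X t = tclass ?X t'" "t' \<in> closed_terms ?X"
      "invertible_term n t'" "commutes_generically n t'"
      by (auto simp: isotropy_group_def)
    obtain w where w: "\<forall>(i, e) \<in> set w. 1 \<le> i \<and> i \<le> n" "reduced w"
      "provable ?X t' (word_term w)"
      using provable_word_term_if_isotropy[OF t'(2-4)] .
    then have "tclass ?X t = tclass ?X (word_term w)"
      unfolding t'(1) by (simp add: tclass_eq_iff[OF t'(2) closed])
    with w show "\<exists>w. (\<forall>(i, e) \<in> set w. 1 \<le> i \<and> i \<le> n) \<and>
        tclass ?X t = tclass ?X (word_term w) \<and> reduced w"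
      by blast
  next
    assume "\<exists>w. (\<forall>(i, e) \<in> set w. 1 \<le> i \<and> i \<le> n) \<and>
        tclass ?X t = tclass ?X (word_term w) \<and> reduced w"
    then obtain w where w: "\<forall>(i, e) \<in> set w. 1 \<le> i \<and> i \<le> n"
      "tclass ?X t = tclass ?X (word_term w)"
      by blast
    \<comment> \<open>Here \<open>word_term w\<close> is the representative with the two required
      properties.\<close>
    then show "tclass ?X t \<in> carrier (isotropy_group n)"
      using closed[OF w(1)] invertible_term_act[OF letters] commutes_generically_act[OF letters]
      unfolding isotropy_group_def by (auto simp: word_term_eq_act)
  qed
qed

end
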